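(* Let $\mathbb{F}\in\{\mathbb{R},\mathbb{C}\}$, let $\mathcal{A}=\{A_1,\ldots,A_K\}\subset\mathbb{M}(n,\mathbb{F})$, let $Q\in GL(n,\mathbb{F})$, and let $Z\in\mathbb{M}(n,\mathbb{F})$. Then for every order $j\geq 1$, $$d^jf_{\mathcal{A}}|_Q(Z)=\frac12\sum_{k=1}^K\sum_{l=0}^j\binom{j}{l}\left\langle d^{j-l}h_k|_Q(Z),\,J\diamond d^lh_k|_Q(Z)\right\rangle_{\mathbb{R}}.$$ In particular, $$df_{\mathcal{A}}|_Q(Z)=\sum_{k=1}^K\left\langle[h_k(Q),Q^{-1}Z],\,J\diamond h_k(Q)\right\rangle_{\mathbb{R}}$$ and $$d^2f_{\mathcal{A}}|_Q(Z)=\sum_{k=1}^K\Big(\big\|J\diamond[h_k(Q),Q^{-1}Z]\big\|^2+2\left\langle[Q^{-1}Z,Q^{-1}Zh_k(Q)],\,J\diamond h_k(Q)\right\rangle_{\mathbb{R}}\Big).$$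
   Context: $\mathbb{M}(n,\mathbb{F})$ is the set of $n\times n$ matrices over $\mathbb{F}$ and $GL(n,\mathbb{F})$ its subset of invertible matrices. $J$ is the $n\times n$ matrix with zeros on the diagonal and ones elsewhere, $X\diamond Y$ is the entrywise (Hadamard) product, $[X,Y]=XY-YX$, $\|\cdot\|$ is the Frobenius norm, $\langle A,B\rangle=\sum_{i,j}A_{ij}\overline{B_{ij}}$ and $\langle A,B\rangle_{\mathbb{R}}=\mathrm{Re}\,\langle A,B\rangle$. The functional $f_{\mathcal{A}}:GL(n,\mathbb{F})\to[0,\infty)$ is $$f_{\mathcal{A}}(Q)=\frac12\sum_{k=1}^K\sum_{i\neq j}\left|(Q^{-1}A_kQ)_{ij}\right|^2=\frac12\sum_{k=1}^K\|J\diamond(Q^{-1}A_kQ)\|^2,$$ and $h_k:GL(n,\mathbb{F})\to\mathbb{M}(n,\mathbb{F})$ is $h_k(Q)=Q^{-1}A_kQ$. For a smooth function $g$ on $GL(n,\mathbb{F})$ (an open subset of $\mathbb{M}(n,\mathbb{F})$, regarded as a real vector space), $d^jg|_Q$ denotes its $j$-th differential at $Q$, a symmetric $j$-multilinear map on $\mathbb{M}(n,\mathbb{F})^j$; $d^jg|_Q(Z)$ abbreviates $d^jg|_Q(Z,\ldots,Z)$, and $d^0g|_Q(Z)=g(Q)$. *)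

theory Defs
  imports "HOL-Analysis.Analysis"
begin

text \<open>
  The matrices over a field are the type \<open>'a^'n^'n\<close>, with \<open>'a\<close> being \<^typ>\<open>real\<close> or
  \<^typ>\<open>complex\<close>.  In both cases the library norm on this type is the Frobenius norm
  (see \<open>norm_matrix_Frobenius\<close> below), and \<open>has_derivative\<close> is differentiation over the reals.
\<close>

definition J_matrix :: "'a::zero_neq_one^'n^'n" where
  "J_matrix = (\<chi> i j. if i = j then 0 else 1)"

definition hadamard :: "'a::times^'n^'m \<Rightarrow> 'a^'n^'m \<Rightarrow> 'a^'n^'m"  (infixl "\<diamond>" 70) where
  "X \<diamond> Y = (\<chi> i j. X $ i $ j * Y $ i $ j)"

definition commutator :: "'a::ring_1^'n^'n \<Rightarrow> 'a^'n^'n \<Rightarrow> 'a^'n^'n" where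
  "commutator X Y = X ** Y - Y ** X"

definition frob_real :: "real^'n^'m \<Rightarrow> real^'n^'m \<Rightarrow> real" where
  "frob_real A B = (\<Sum>i\<in>UNIV. \<Sum>j\<in>UNIV. A $ i $ j * B $ i $ j)"

definition frob_complex :: "complex^'n^'m \<Rightarrow> complex^'n^'m \<Rightarrow> complex" where
  "frob_complex A B = (\<Sum>i\<in>UNIV. \<Sum>j\<in>UNIV. A $ i $ j * cnj (B $ i $ j))"

text \<open>
  The map \<open>h\<^sub>k\<close> is \<open>sim (A k)\<close>.  Both \<open>sim\<close> and \<open>f_functional\<close> are meaningful only at invertible
  \<open>Q\<close>; the invertible matrices form an open set, so the values elsewhere do not affect
  derivatives at an invertible matrix.
\<close>

definition sim :: "'a::semiring_1^'n^'n \<Rightarrow> 'a^'n^'n \<Rightarrow> 'a^'n^'n" where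
  "sim A Q = matrix_inv Q ** A ** Q"

definition f_functional ::
    "nat \<Rightarrow> (nat \<Rightarrow> 'a::real_normed_field^'n^'n) \<Rightarrow> 'a^'n^'n \<Rightarrow> real" where
  "f_functional K A Q =
     1/2 * (\<Sum>k=1..K. \<Sum>(i,j)\<in>{(i,j). i \<noteq> j}. (norm ((matrix_inv Q ** A k ** Q) $ i $ j))\<^sup>2)"

text \<open>
  \<open>differential g [Z\<^sub>1, \<dots>, Z\<^sub>j] Q\<close> is the \<open>j\<close>-th differential of \<open>g\<close> at \<open>Q\<close> evaluated on
  \<open>(Z\<^sub>1, \<dots>, Z\<^sub>j)\<close>: the (real) Frechet derivative at \<open>Q\<close>, in direction \<open>Z\<^sub>1\<close>, of the
  \<open>(j-1)\<close>-st differential with arguments \<open>(Z\<^sub>2, \<dots>, Z\<^sub>j)\<close>.  On a finite-dimensional domain,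
  differentiating the multilinear-map-valued \<open>(j-1)\<close>-st differential is the same as
  differentiating its values on fixed arguments.
\<close>

primrec differential ::
    "('a::real_normed_vector \<Rightarrow> 'b::real_normed_vector) \<Rightarrow> 'a list \<Rightarrow> 'a \<Rightarrow> 'b" where
  "differential g [] = g"
| "differential g (Z # Zs) = (\<lambda>Q. frechet_derivative (differential g Zs) (at Q) Z)"

definition diff_pow ::
    "nat \<Rightarrow> ('a::real_normed_vector \<Rightarrow> 'b::real_normed_vector) \<Rightarrow> 'a \<Rightarrow> 'a \<Rightarrow> 'b" where
  "diff_pow j g Q Z = differential g (replicate j Z) Q"

lemma norm_matrix_Frobenius:
  fixes X :: "'a::real_normed_field^'n^'m"
  shows "(norm X)\<^sup>2 = (\<Sum>i\<in>UNIV. \<Sum>j\<in>UNIV. (norm (X $ i $ j))\<^sup>2)"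
  by (simp add: norm_vec_def L2_set_def sum_nonneg)

lemma f_functional_eq_norm:
  fixes A :: "nat \<Rightarrow> 'a::real_normed_field^'n^'n"
  shows "f_functional K A Q = 1/2 * (\<Sum>k=1..K. (norm (J_matrix \<diamond> sim (A k) Q))\<^sup>2)"
proof -
  have "(\<Sum>(i,j)\<in>{(i,j). i \<noteq> j}. (norm (X $ i $ j))\<^sup>2) = (norm (J_matrix \<diamond> X))\<^sup>2"
    for X :: "'a^'n^'n"
  proof -
    have "(norm (J_matrix \<diamond> X))\<^sup>2 =
        (\<Sum>(i,j)\<in>UNIV. (norm ((J_matrix \<diamond> X) $ i $ j))\<^sup>2)"
      by (simp add: norm_matrix_Frobenius sum.cartesian_product)
    also have "\<dots> = (\<Sum>(i,j)\<in>{(i,j). i \<noteq> j}. (norm (X $ i $ j))\<^sup>2)"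
      by (rule sum.mono_neutral_cong_right) (auto simp: J_matrix_def hadamard_def)
    finally show ?thesis by simp
  qed
  then show ?thesis by (simp add: f_functional_def sim_def)
qed

end

theory Submission
  imports Defs
begin

text \<open>
  The functional is half the sum over \<open>k\<close> of
  \<open>\<parallel>J \<diamond> h\<^sub>k\<parallel>\<^sup>2\<close>.  The Hadamard product with \<open>J\<close> is a self-adjoint projection, so
  \<open>\<parallel>J \<diamond> X\<parallel>\<^sup>2 = X \<bullet> (J \<diamond> X)\<close>: the functional is a sum of a bounded bilinear form evaluated at
  \<open>(h\<^sub>k, h\<^sub>k)\<close>, and its higher differentials on the diagonal are given by the Leibniz rule.

  Differentials with all arguments equal to \<open>Z\<close> are obtained by repeatedly differentiating a
  function and evaluating the derivative on \<open>Z\<close>.  They are computed here through \<^emph>\<open>jets\<close>: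
  sequences \<open>G\<close> of functions on an open set such that each \<open>G j\<close> is differentiable with derivative
  \<open>G (Suc j)\<close> in direction \<open>Z\<close>.  A jet that starts with \<open>g\<close> consists of the iterated differentials
  of \<open>g\<close> (\<open>diff_pow_eq_jet\<close>), and jets are closed under sums and, by Pascal's rule, under the
  Leibniz formula (\<open>jet_on_bilinear\<close>).

  What remains is a jet for \<open>h = sim A\<close> on the open set of invertible matrices.  Put
  \<open>W = Q\<^sup>-\<^sup>1 Z\<close>.  In direction \<open>Z\<close> the derivative of \<open>W\<close> is \<open>- W W\<close> and that of \<open>h\<close> is \<open>[h, W]\<close>;
  hence the derivative of \<open>W\<^sup>m [W, h]\<close> is \<open>- (m + 2) W\<^sup>m\<^sup>+\<^sup>1 [W, h]\<close>.  So for \<open>j \<ge> 1\<close> the \<open>j\<close>-th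
  differential of \<open>h\<close> is \<open>(- 1)\<^sup>j j! W\<^sup>j\<^sup>-\<^sup>1 [W, h]\<close> (\<open>jet_on_similarity_jet\<close>).  The cases \<open>j = 1\<close> and
  \<open>j = 2\<close>, namely \<open>[h, W]\<close> and \<open>2 W [W, h] = 2 [W, W h]\<close>, turn the Leibniz formula into the two
  explicit ones.

  Real and complex matrices are treated at once, over a normed field that is a Euclidean space,
  because the real inner product of the library is \<open>frob_real\<close> in the first case and the real part
  of \<open>frob_complex\<close> in the second.
\<close>

section \<open>Derivatives along a fixed direction\<close>

text \<open>
  The full derivative has to exist: directional differentiability alone would not determine
  \<^const>\<open>frechet_derivative\<close>.
\<close>

definition has_derivative_along ::
    "('a::real_normed_vector \<Rightarrow> 'b::real_normed_vector) \<Rightarrow> 'b \<Rightarrow> 'a \<Rightarrow> 'a \<Rightarrow> bool" where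
  "has_derivative_along g v Q Z \<longleftrightarrow> (\<exists>D. (g has_derivative D) (at Q) \<and> D Z = v)"

lemma has_derivative_alongI:
  "(g has_derivative D) (at Q) \<Longrightarrow> D Z = v \<Longrightarrow> has_derivative_along g v Q Z"
  by (auto simp: has_derivative_along_def)

lemma frechet_derivative_along:
  "has_derivative_along g v Q Z \<Longrightarrow> frechet_derivative g (at Q) Z = v"
  unfolding has_derivative_along_def using frechet_derivative_at by metis

lemma differentiable_has_derivative_along:
  "g differentiable at Q \<Longrightarrow> has_derivative_along g (frechet_derivative g (at Q) Z) Q Z"
  using frechet_derivative_works has_derivative_alongI by blast

lemma has_derivative_along_transform:
  assumes "has_derivative_along g v Q Z" "open S" "Q \<in> S" "\<And>P. P \<in> S \<Longrightarrow> g P = g' P"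
  shows "has_derivative_along g' v Q Z"
  using assms has_derivative_transform_within_open unfolding has_derivative_along_def by metis

lemma has_derivative_along_const: "has_derivative_along (\<lambda>P. c) 0 Q Z"
  by (rule has_derivative_alongI[where D="\<lambda>_. 0"]) auto

lemma has_derivative_along_ident: "has_derivative_along (\<lambda>P. P) Z Q Z"
  by (rule has_derivative_alongI[where D="\<lambda>H. H"]) auto

lemma has_derivative_along_bilinear:
  assumes "bounded_bilinear B" "has_derivative_along g v Q Z" "has_derivative_along h w Q Z"
  shows "has_derivative_along (\<lambda>P. B (g P) (h P)) (B (g Q) w + B v (h Q)) Q Z"
  using assms bounded_bilinear.FDERIV[OF assms(1)]
  unfolding has_derivative_along_def by blast

lemma has_derivative_along_linear:
  assumes "bounded_linear L" "has_derivative_along g v Q Z"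
  shows "has_derivative_along (\<lambda>P. L (g P)) (L v) Q Z"
  using assms bounded_linear.has_derivative
  unfolding has_derivative_along_def by blast

lemma has_derivative_along_sum:
  assumes "\<And>i. i \<in> I \<Longrightarrow> has_derivative_along (g i) (v i) Q Z"
  shows "has_derivative_along (\<lambda>P. \<Sum>i\<in>I. g i P) (\<Sum>i\<in>I. v i) Q Z"
proof -
  obtain D where "\<And>i. i \<in> I \<Longrightarrow> (g i has_derivative D i) (at Q) \<and> D i Z = v i"
    using assms unfolding has_derivative_along_def by metis
  then show ?thesis
    by (intro has_derivative_alongI[where D="\<lambda>H. \<Sum>i\<in>I. D i H"] has_derivative_sum)
      (auto intro: sum.cong)
qed

lemma has_derivative_along_diff:
  assumes "has_derivative_along g v Q Z" "has_derivative_along h w Q Z"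
  shows "has_derivative_along (\<lambda>P. g P - h P) (v - w) Q Z"
  using assms has_derivative_diff unfolding has_derivative_along_def by blast

section \<open>Jets and the Leibniz rule\<close>

definition jet_on ::
    "'a::real_normed_vector set \<Rightarrow> 'a \<Rightarrow> (nat \<Rightarrow> 'a \<Rightarrow> 'b::real_normed_vector) \<Rightarrow> bool" where
  "jet_on S Z G \<longleftrightarrow> (\<forall>j. \<forall>Q\<in>S. has_derivative_along (G j) (G (Suc j) Q) Q Z)"

lemma diff_pow_Suc:
  "diff_pow (Suc j) g Q Z = frechet_derivative (\<lambda>P. diff_pow j g P Z) (at Q) Z"
  by (simp add: diff_pow_def)

text \<open>
  The set is open, so \<open>G j\<close> and the \<open>j\<close>-th differential, once they agree on it, have the same
  derivatives there.
\<close>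

lemma diff_pow_eq_jet:
  assumes "jet_on S Z G" "open S" "\<And>P. P \<in> S \<Longrightarrow> g P = G 0 P" "Q \<in> S"
  shows "diff_pow j g Q Z = G j Q"
  using assms(4)
proof (induction j arbitrary: Q)
  case 0
  then show ?case using assms(3) by (simp add: diff_pow_def)
next
  case (Suc j)
  have "has_derivative_along (G j) (G (Suc j) Q) Q Z"
    using assms(1) Suc.prems by (auto simp: jet_on_def)
  then have "has_derivative_along (\<lambda>P. diff_pow j g P Z) (G (Suc j) Q) Q Z"
    by (rule has_derivative_along_transform[OF _ assms(2) Suc.prems]) (simp add: Suc.IH)
  then show ?case
    by (simp add: diff_pow_Suc frechet_derivative_along)
qed

lemma jet_on_sum:
  assumes "\<And>i. i \<in> I \<Longrightarrow> jet_on S Z (G i)"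
  shows "jet_on S Z (\<lambda>j P. \<Sum>i\<in>I. G i j P)"
  using assms by (auto simp: jet_on_def intro!: has_derivative_along_sum)

text \<open>
  This is the combinatorial part of the Leibniz rule: each term splits into two when it is
  differentiated, and Pascal's rule collects the pieces.
\<close>

lemma binomial_sum_Suc:
  fixes a :: "nat \<Rightarrow> 'a::real_vector"
  shows "(\<Sum>l=0..j. real (j choose l) *\<^sub>R (a l + a (Suc l))) =
    (\<Sum>l=0..Suc j. real (Suc j choose l) *\<^sub>R a l)"
proof -
  have "(\<Sum>l\<le>Suc j. real (Suc j choose l) *\<^sub>R a l) =
      a 0 + (\<Sum>l\<le>j. real (j choose l) *\<^sub>R a (Suc l)) + (\<Sum>l\<le>j. real (j choose Suc l) *\<^sub>R a (Suc l))"
    by (subst sum.atMost_Suc_shift) (simp add: scaleR_add_left sum.distrib)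
  moreover have "(\<Sum>l\<le>j. real (j choose l) *\<^sub>R a l) =
      a 0 + (\<Sum>l\<le>j. real (j choose Suc l) *\<^sub>R a (Suc l))"
    using sum.atMost_Suc_shift[of "\<lambda>l. real (j choose l) *\<^sub>R a l" j]
    by (simp del: binomial_Suc_Suc add: binomial_eq_0)
  ultimately show ?thesis
    by (simp add: scaleR_add_right sum.distrib atLeast0AtMost del: sum.atMost_Suc)
qed

lemma jet_on_bilinear:
  assumes B: "bounded_bilinear B" and G: "jet_on S Z G" and H: "jet_on S Z H"
  shows "jet_on S Z (\<lambda>j P. \<Sum>l=0..j. real (j choose l) *\<^sub>R B (G (j - l) P) (H l P))"
  unfolding jet_on_def
proof (intro allI ballI)
  fix j Q assume Q: "Q \<in> S"
  \<comment> \<open>Differentiating the left or the right factor of the \<open>l\<close>-th term gives \<open>a l\<close> or \<open>a (Suc l)\<close>.\<close>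
  define a where "a l = B (G (Suc j - l) Q) (H l Q)" for l
  have "has_derivative_along (\<lambda>P. \<Sum>l=0..j. real (j choose l) *\<^sub>R B (G (j - l) P) (H l P))
     (\<Sum>l=0..j. real (j choose l) *\<^sub>R
        (B (G (j - l) Q) (H (Suc l) Q) + B (G (Suc (j - l)) Q) (H l Q))) Q Z"
    using G H Q unfolding jet_on_def
    by (intro has_derivative_along_sum has_derivative_along_linear[OF bounded_linear_scaleR_right]
        has_derivative_along_bilinear[OF B]) auto
  also have "(\<Sum>l=0..j. real (j choose l) *\<^sub>R
        (B (G (j - l) Q) (H (Suc l) Q) + B (G (Suc (j - l)) Q) (H l Q))) =
      (\<Sum>l=0..j. real (j choose l) *\<^sub>R (a l + a (Suc l)))"
    by (intro sum.cong refl) (simp add: a_def Suc_diff_le add.commute)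
  finally show "has_derivative_along (\<lambda>P. \<Sum>l=0..j. real (j choose l) *\<^sub>R B (G (j - l) P) (H l P))
     (\<Sum>l=0..Suc j. real (Suc j choose l) *\<^sub>R B (G (Suc j - l) Q) (H l Q)) Q Z"
    using binomial_sum_Suc[of j a] by (simp add: a_def)
qed

section \<open>Differentiability of the matrix inverse\<close>

lemma matrix_diff_ldistrib: "A ** (B - C) = A ** B - A ** (C::'a::ring_1^'k^'n)"
  by (simp add: vec_eq_iff matrix_matrix_mult_def algebra_simps sum_subtractf)

lemma matrix_diff_rdistrib: "(A - B) ** C = A ** C - B ** (C::'a::ring_1^'k^'n)"
  by (simp add: vec_eq_iff matrix_matrix_mult_def algebra_simps sum_subtractf)

lemma bounded_bilinear_matrix_mult:
  "bounded_bilinear ((**) ::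
     'a::{real_normed_field,euclidean_space}^'n^'m \<Rightarrow> 'a^'k^'n \<Rightarrow> 'a^'k^'m)"
  unfolding bilinear_conv_bounded_bilinear[symmetric] bilinear_def linear_iff
  by (simp add: vec_eq_iff matrix_matrix_mult_def algebra_simps sum.distrib scaleR_sum_right)

lemma matrix_inv_right: "invertible Q \<Longrightarrow> Q ** matrix_inv Q = mat 1"
  and matrix_inv_left: "invertible Q \<Longrightarrow> matrix_inv Q ** Q = mat 1"
  unfolding invertible_def matrix_inv_def by (rule someI2_ex; simp)+

lemma differentiable_det:
  fixes g :: "'b::real_normed_vector \<Rightarrow> 'a::real_normed_field^'n^'n"
  assumes "\<And>i j. (\<lambda>P. g P $ i $ j) differentiable (at Q within S)"
  shows "(\<lambda>P. det (g P)) differentiable (at Q within S)"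
proof -
  have "(\<lambda>P. \<Prod>i\<in>UNIV. g P $ i $ p i) differentiable (at Q within S)" for p
  proof -
    have "\<forall>i. \<exists>D. ((\<lambda>P. g P $ i $ p i) has_derivative D) (at Q within S)"
      using assms by (auto simp: differentiable_def)
    then obtain D where "\<And>i. ((\<lambda>P. g P $ i $ p i) has_derivative D i) (at Q within S)"
      by metis
    then show ?thesis
      by (rule differentiableI[OF has_derivative_prod])
  qed
  then show ?thesis
    unfolding det_def
    by (intro differentiable_sum ballI differentiable_mult differentiable_const finite_permutations finite)
qed

lemma differentiable_matrix_entry: "(\<lambda>P::'a::real_normed_vector^'n^'m. P $ i $ j) differentiable F"
  using bounded_linear_compose[OF bounded_linear_vec_nth bounded_linear_vec_nth]
   bounded_linear_imp_differentiable by blast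

lemma open_invertible: "open {Q::'a::real_normed_field^'n^'n. invertible Q}"
proof -
  have "continuous_on UNIV (det :: 'a^'n^'n \<Rightarrow> 'a)"
    unfolding continuous_on_eq_continuous_within
    by (intro ballI differentiable_imp_continuous_within differentiable_det differentiable_matrix_entry)
  then have "open (det -` (- {0}) :: ('a^'n^'n) set)"
    by (intro open_vimage) auto
  then show ?thesis
    by (simp add: vimage_def invertible_det_nz)
qed

text \<open>
  Cramer's rule for the equation \<open>Q x = e\<^sub>m\<close>, whose solution is the \<open>m\<close>-th column of the inverse.  It
  shows that the entries of the inverse are rational functions of those of \<open>Q\<close>.
\<close>

lemma matrix_inv_cramer:
  fixes Q :: "'a::field^'n^'n"
  assumes "invertible Q"
  shows "matrix_inv Q $ k $ m =
    det (\<chi> i j. if j = k then (if i = m then 1 else 0) else Q $ i $ j) / det Q"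
proof -
  have "Q *v column m (matrix_inv Q) = (\<chi> i. if i = m then 1 else 0)"
    using matrix_inv_right[OF assms]
    by (simp add: vec_eq_iff matrix_matrix_mult_def matrix_vector_mult_def column_def mat_def)
  then have "column m (matrix_inv Q) =
      (\<chi> k. det (\<chi> i j. if j = k then (\<chi> i. if i = m then 1 else 0) $ i else Q $ i $ j) / det Q)"
    by (rule iffD1[OF cramer, rotated]) (use assms in \<open>simp add: invertible_det_nz\<close>)
  then show ?thesis
    by (simp add: vec_eq_iff column_def cong: if_cong)
qed

lemma differentiable_matrix_inv:
  fixes Q :: "'a::{real_normed_field,euclidean_space}^'n^'n"
  assumes Q: "invertible Q"
  shows "matrix_inv differentiable at Q"
proof -
  have entry: "(\<lambda>P. matrix_inv P $ k $ m) differentiable at Q" for k m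
  proof -
    have "(\<lambda>P. if j = k then (if i = m then 1 else 0) else P $ i $ j) differentiable at Q" for i j
      by (cases "j = k") (auto simp: differentiable_matrix_entry)
    then have "(\<lambda>P. det (\<chi> i j. if j = k then (if i = m then 1 else 0) else P $ i $ j) / det P)
        differentiable at Q"
      using Q by (intro differentiable_divide differentiable_det)
        (auto simp: invertible_det_nz differentiable_matrix_entry)
    then show ?thesis
      unfolding differentiable_def
      by (elim exE, rule_tac exI)
       (rule has_derivative_transform_within_open[OF _ open_invertible], use Q in \<open>auto simp: matrix_inv_cramer\<close>)
  qed
  have "(\<lambda>P. matrix_inv P \<bullet> b) differentiable at Q" if "b \<in> Basis" for b :: "'a^'n^'n"
  proof -
    have "(\<lambda>P. \<Sum>k\<in>UNIV. \<Sum>m\<in>UNIV. matrix_inv P $ k $ m \<bullet> b $ k $ m) differentiable at Q"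
      using entry by (intro differentiable_sum ballI finite differentiable_inner) auto
    then show ?thesis by (simp add: inner_vec_def)
  qed
  then show ?thesis
    using differentiable_componentwise_within[of matrix_inv] by blast
qed

lemma has_derivative_along_matrix_mult:
  fixes g :: "'b::real_normed_vector \<Rightarrow> 'a::{real_normed_field,euclidean_space}^'n^'m"
  assumes "has_derivative_along g v Q Z" "has_derivative_along h w Q Z"
  shows "has_derivative_along (\<lambda>P. g P ** h P) (g Q ** w + v ** h Q) Q Z"
  by (rule has_derivative_along_bilinear[OF bounded_bilinear_matrix_mult assms])

text \<open>
  Differentiability being known, the value of the derivative is forced by differentiating
  \<open>P P\<^sup>-\<^sup>1 = 1\<close>.
\<close>

lemma has_derivative_along_matrix_inv:
  fixes Q :: "'a::{real_normed_field,euclidean_space}^'n^'n"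
  assumes Q: "invertible Q"
  shows "has_derivative_along matrix_inv (- (matrix_inv Q ** Z ** matrix_inv Q)) Q Z"
proof -
  let ?R = "matrix_inv Q"
  let ?v = "frechet_derivative matrix_inv (at Q) Z"
  have inv: "has_derivative_along matrix_inv ?v Q Z"
    by (rule differentiable_has_derivative_along[OF differentiable_matrix_inv[OF Q]])
  have "has_derivative_along (\<lambda>P. P ** matrix_inv P) (Q ** ?v + Z ** ?R) Q Z"
    by (rule has_derivative_along_matrix_mult[OF has_derivative_along_ident inv])
  then have "has_derivative_along (\<lambda>P. mat 1 :: 'a^'n^'n) (Q ** ?v + Z ** ?R) Q Z"
    by (rule has_derivative_along_transform[OF _ open_invertible]) (use Q in \<open>auto simp: matrix_inv_right\<close>)
  then have "Q ** ?v + Z ** ?R = 0"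
    using frechet_derivative_along has_derivative_along_const by metis
  then have "?R ** (Q ** ?v + Z ** ?R) = 0"
    by simp
  then have "?v + ?R ** Z ** ?R = 0"
    by (simp add: matrix_add_ldistrib matrix_mul_assoc matrix_inv_left[OF Q])
  then have "?v = - (?R ** Z ** ?R)"
    by (simp add: eq_neg_iff_add_eq_0)
  with inv show ?thesis by simp
qed

section \<open>Differentials of the similarity map\<close>

text \<open>
  The coefficients come from the expansion of \<open>sim A (Q + t Z) = (1 + t W)\<^sup>-\<^sup>1 h (1 + t W)\<close>, where
  \<open>W = Q\<^sup>-\<^sup>1 Z\<close> and \<open>h = sim A Q\<close>: for \<open>j \<ge> 1\<close> the coefficient of \<open>t\<^sup>j\<close> is
  \<open>(- 1)\<^sup>j (W\<^sup>j h - W\<^sup>j\<^sup>-\<^sup>1 h W) = (- 1)\<^sup>j W\<^sup>j\<^sup>-\<^sup>1 [W, h]\<close>.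
\<close>

definition similarity_jet ::
    "'a::real_normed_field^'n^'n \<Rightarrow> 'a^'n^'n \<Rightarrow> nat \<Rightarrow> 'a^'n^'n \<Rightarrow> 'a^'n^'n" where
  "similarity_jet A Z j Q =
     (if j = 0 then sim A Q
      else ((-1) ^ j * fact j) *\<^sub>R
        (((**) (matrix_inv Q ** Z) ^^ (j - 1)) (commutator (matrix_inv Q ** Z) (sim A Q))))"

lemma has_derivative_along_inv_mult:
  fixes Q Z :: "'a::{real_normed_field,euclidean_space}^'n^'n"
  assumes Q: "invertible Q"
  shows "has_derivative_along (\<lambda>P. matrix_inv P ** Z) (- ((matrix_inv Q ** Z) ** (matrix_inv Q ** Z))) Q Z"
  using has_derivative_along_matrix_mult[OF has_derivative_along_matrix_inv[OF Q]
      has_derivative_along_const]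
  by (simp add: matrix_mul_assoc bounded_bilinear.minus_left[OF bounded_bilinear_matrix_mult])

lemma has_derivative_along_sim:
  fixes A Q Z :: "'a::{real_normed_field,euclidean_space}^'n^'n"
  assumes Q: "invertible Q"
  shows "has_derivative_along (sim A) (commutator (sim A Q) (matrix_inv Q ** Z)) Q Z"
proof -
  have "has_derivative_along (sim A)
     (matrix_inv Q ** A ** Z + (matrix_inv Q ** 0 + - (matrix_inv Q ** Z ** matrix_inv Q) ** A) ** Q) Q Z"
    unfolding sim_def
    by (intro has_derivative_along_matrix_mult has_derivative_along_matrix_inv[OF Q]
      has_derivative_along_const has_derivative_along_ident)
  \<comment> \<open>Inserting \<open>Q Q\<^sup>-\<^sup>1\<close> exhibits the first term as \<open>h W\<close>.\<close>
  moreover have "matrix_inv Q ** A ** Z = matrix_inv Q ** A ** Q ** matrix_inv Q ** Z"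
    by (metis matrix_mul_assoc matrix_inv_right[OF Q] matrix_mul_lid)
  ultimately show ?thesis
    by (simp add: commutator_def sim_def matrix_mul_assoc bounded_bilinear.minus_left[OF bounded_bilinear_matrix_mult])
qed

text \<open>
  With \<open>W' = - W W\<close> and \<open>h' = [h, W]\<close>, the derivative of \<open>[W, h]\<close> is
  \<open>- [W W, h] + [W, [h, W]] = - 2 W [W, h]\<close>, and every further factor \<open>W\<close> on the left contributes
  one more \<open>- W\<close>.
\<close>

lemma has_derivative_along_power_commutator:
  fixes A Q Z :: "'a::{real_normed_field,euclidean_space}^'n^'n"
  assumes Q: "invertible Q"
  shows "has_derivative_along (\<lambda>P. ((**) (matrix_inv P ** Z) ^^ m) (commutator (matrix_inv P ** Z) (sim A P)))
    (- real (m + 2) *\<^sub>R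
      (((**) (matrix_inv Q ** Z) ^^ Suc m) (commutator (matrix_inv Q ** Z) (sim A Q)))) Q Z"
proof (induction m)
  case 0
  let ?W = "matrix_inv Q ** Z" and ?h = "sim A Q"
  have "has_derivative_along (\<lambda>P. commutator (matrix_inv P ** Z) (sim A P))
     ((?W ** commutator ?h ?W + - (?W ** ?W) ** ?h) - (?h ** - (?W ** ?W) + commutator ?h ?W ** ?W)) Q Z"
    unfolding commutator_def[of "_ ** _"]
    by (intro has_derivative_along_diff has_derivative_along_matrix_mult
       has_derivative_along_inv_mult has_derivative_along_sim Q)
  also have "((?W ** commutator ?h ?W + - (?W ** ?W) ** ?h) - (?h ** - (?W ** ?W) + commutator ?h ?W ** ?W)) =
     - real (0 + 2) *\<^sub>R (?W ** commutator ?W ?h)"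
    by (simp add: commutator_def matrix_diff_ldistrib matrix_diff_rdistrib matrix_mul_assoc
        bounded_bilinear.minus_left[OF bounded_bilinear_matrix_mult] bounded_bilinear.minus_right[OF bounded_bilinear_matrix_mult] scaleR_2)
  finally show ?case by simp
next
  case (Suc m)
  let ?W = "matrix_inv Q ** Z"
  let ?F = "((**) ?W ^^ m) (commutator ?W (sim A Q))"
  have "has_derivative_along
     (\<lambda>P. (matrix_inv P ** Z) ** ((**) (matrix_inv P ** Z) ^^ m) (commutator (matrix_inv P ** Z) (sim A P)))
     (?W ** (- real (m + 2) *\<^sub>R (((**) ?W ^^ Suc m) (commutator ?W (sim A Q)))) + - (?W ** ?W) ** ?F) Q Z"
    by (rule has_derivative_along_matrix_mult[OF has_derivative_along_inv_mult[OF Q] Suc.IH])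
  also have "?W ** (- real (m + 2) *\<^sub>R (((**) ?W ^^ Suc m) (commutator ?W (sim A Q)))) + - (?W ** ?W) ** ?F =
     (- real (m + 2) - 1) *\<^sub>R (?W ** (?W ** ?F))"
    unfolding scaleR_diff_left
    by (simp only: bounded_bilinear.scaleR_right[OF bounded_bilinear_matrix_mult] scaleR_one funpow.simps o_def
       bounded_bilinear.minus_left[OF bounded_bilinear_matrix_mult] matrix_mul_assoc
       add_uminus_conv_diff)
  finally show ?case by simp
qed

lemma jet_on_similarity_jet:
  fixes A Z :: "'a::{real_normed_field,euclidean_space}^'n^'n"
  shows "jet_on {Q. invertible Q} Z (similarity_jet A Z)"
  unfolding jet_on_def
proof (intro allI ballI)
  fix j and Q :: "'a^'n^'n" assume "Q \<in> {Q. invertible Q}"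
  then have Q: "invertible Q" by simp
  show "has_derivative_along (similarity_jet A Z j) (similarity_jet A Z (Suc j) Q) Q Z"
  proof (cases j)
    case 0
    then show ?thesis
      using has_derivative_along_sim[OF Q, of A Z]
      by (simp add: similarity_jet_def [abs_def] commutator_def)
  next
    case (Suc m)
    let ?c = "(-1) ^ j * fact j :: real"
    let ?F = "\<lambda>i P. ((**) (matrix_inv P ** Z) ^^ i) (commutator (matrix_inv P ** Z) (sim A P))"
    have "has_derivative_along (\<lambda>P. ?c *\<^sub>R ?F m P) (?c *\<^sub>R (- real (m + 2) *\<^sub>R ?F (Suc m) Q)) Q Z"
      by (rule has_derivative_along_linear[OF bounded_linear_scaleR_right
            has_derivative_along_power_commutator[OF Q]])
    moreover have "similarity_jet A Z j = (\<lambda>P. ?c *\<^sub>R ?F m P)"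
      by (simp add: similarity_jet_def Suc fun_eq_iff del: fact_Suc)
    moreover have "?c * - real (m + 2) = (-1) ^ Suc j * fact (Suc j)"
      by (simp add: Suc algebra_simps)
    then have "similarity_jet A Z (Suc j) Q = ?c *\<^sub>R (- real (m + 2) *\<^sub>R ?F (Suc m) Q)"
      unfolding similarity_jet_def scaleR_scaleR by (simp only: Suc) simp
    ultimately show ?thesis by simp
  qed
qed

lemma diff_pow_sim:
  fixes A Q Z :: "'a::{real_normed_field,euclidean_space}^'n^'n"
  assumes "invertible Q"
  shows "diff_pow j (sim A) Q Z = similarity_jet A Z j Q"
  by (rule diff_pow_eq_jet[OF jet_on_similarity_jet open_invertible])
    (use assms in \<open>auto simp: similarity_jet_def\<close>)

lemma diff_pow_1_sim:
  fixes A Q Z :: "'a::{real_normed_field,euclidean_space}^'n^'n"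
  assumes "invertible Q"
  shows "diff_pow 1 (sim A) Q Z = commutator (sim A Q) (matrix_inv Q ** Z)"
  using assms by (simp add: diff_pow_sim similarity_jet_def commutator_def)

lemma diff_pow_2_sim:
  fixes A Q Z :: "'a::{real_normed_field,euclidean_space}^'n^'n"
  assumes "invertible Q"
  shows "diff_pow 2 (sim A) Q Z =
    2 *\<^sub>R commutator (matrix_inv Q ** Z) (matrix_inv Q ** Z ** sim A Q)"
  using assms
  by (simp add: diff_pow_sim similarity_jet_def commutator_def matrix_diff_ldistrib matrix_mul_assoc)

section \<open>Differentials of the functional\<close>

lemma inner_J_hadamard:
  fixes X Y :: "'a::{real_normed_field,real_inner}^'n^'n"
  shows "X \<bullet> (J_matrix \<diamond> Y) = (\<Sum>i\<in>UNIV. \<Sum>j\<in>UNIV. if i = j then 0 else X $ i $ j \<bullet> Y $ i $ j)"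
  unfolding inner_vec_def
  by (intro sum.cong refl) (auto simp: hadamard_def J_matrix_def)

lemma inner_J_hadamard_commute:
  fixes X Y :: "'a::{real_normed_field,real_inner}^'n^'n"
  shows "X \<bullet> (J_matrix \<diamond> Y) = Y \<bullet> (J_matrix \<diamond> X)"
  by (simp add: inner_J_hadamard inner_commute cong: if_cong)

lemma inner_J_hadamard_self:
  fixes X :: "'a::{real_normed_field,real_inner}^'n^'n"
  shows "X \<bullet> (J_matrix \<diamond> X) = (norm (J_matrix \<diamond> X))\<^sup>2"
proof -
  have "J_matrix \<diamond> (J_matrix \<diamond> X) = J_matrix \<diamond> X"
    by (simp add: vec_eq_iff hadamard_def J_matrix_def)
  then show ?thesis
    using inner_J_hadamard_commute[of X "J_matrix \<diamond> X"] by (simp add: power2_norm_eq_inner)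
qed

lemma bounded_bilinear_inner_J_hadamard:
  "bounded_bilinear (\<lambda>X Y::'a::{real_normed_field,euclidean_space}^'n^'n. X \<bullet> (J_matrix \<diamond> Y))"
proof -
  have "linear (\<lambda>Y::'a^'n^'n. J_matrix \<diamond> Y)"
    by (simp add: linear_iff vec_eq_iff hadamard_def algebra_simps)
  then show ?thesis
    using bounded_bilinear.comp[OF bounded_bilinear_inner bounded_linear_ident]
    by (simp add: linear_conv_bounded_linear)
qed

text \<open>
  The Leibniz rule for the bilinear form \<open>(X, Y) \<mapsto> (1/2) (X \<bullet> (J \<diamond> Y))\<close>, summed over \<open>k\<close>.
\<close>

lemma diff_pow_f_functional:
  fixes A :: "nat \<Rightarrow> 'a::{real_normed_field,euclidean_space}^'n^'n"
  assumes Q: "invertible Q"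
  shows "diff_pow j (f_functional K A) Q Z =
    1/2 * (\<Sum>k=1..K. \<Sum>l=0..j. real (j choose l) *
      (diff_pow (j - l) (sim (A k)) Q Z \<bullet> (J_matrix \<diamond> diff_pow l (sim (A k)) Q Z)))"
proof -
  let ?S = "{Q::'a^'n^'n. invertible Q}"
  let ?G = "\<lambda>j P. \<Sum>k=1..K. \<Sum>l=0..j. real (j choose l) *\<^sub>R
      (1/2 * (similarity_jet (A k) Z (j - l) P \<bullet> (J_matrix \<diamond> similarity_jet (A k) Z l P)))"
  have "bounded_bilinear (\<lambda>X Y::'a^'n^'n. 1/2 * (X \<bullet> (J_matrix \<diamond> Y)))"
    using bounded_bilinear.comp[OF bounded_bilinear_inner_J_hadamard
        bounded_linear_scaleR_right[of "1/2"] bounded_linear_ident]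
    by simp
  then have "jet_on ?S Z ?G"
    by (intro jet_on_sum jet_on_bilinear jet_on_similarity_jet)
  then have "diff_pow j (f_functional K A) Q Z = ?G j Q"
    by (rule diff_pow_eq_jet[OF _ open_invertible])
      (use Q in \<open>auto simp: f_functional_eq_norm similarity_jet_def inner_J_hadamard_self sum_distrib_left\<close>)
  then show ?thesis
    using Q by (simp add: diff_pow_sim sum_distrib_left mult.left_commute)
qed

text \<open>
  The form \<open>X \<bullet> (J \<diamond> Y)\<close> is symmetric, so the two terms of the Leibniz sum coincide and cancel the
  factor \<open>1/2\<close>.
\<close>

lemma diff_pow_1_f_functional:
  fixes A :: "nat \<Rightarrow> 'a::{real_normed_field,euclidean_space}^'n^'n"
  assumes Q: "invertible Q"
  shows "diff_pow 1 (f_functional K A) Q Z =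
    (\<Sum>k=1..K. commutator (sim (A k) Q) (matrix_inv Q ** Z) \<bullet> (J_matrix \<diamond> sim (A k) Q))"
proof -
  have "diff_pow 0 (sim B) Q Z = sim B Q" for B
    by (simp add: diff_pow_def)
  then show ?thesis
    unfolding diff_pow_f_functional[OF Q]
    using diff_pow_1_sim[OF Q, of _ Z]
      inner_J_hadamard_commute[of "sim _ Q"]
    by (simp add: sum_distrib_left)
qed

text \<open>
  The middle term of the Leibniz sum gives the square of the norm, because the Hadamard product with
  \<open>J\<close> is a projection; the outer two coincide by symmetry.
\<close>

lemma diff_pow_2_f_functional:
  fixes A :: "nat \<Rightarrow> 'a::{real_normed_field,euclidean_space}^'n^'n"
  assumes Q: "invertible Q"
  shows "diff_pow 2 (f_functional K A) Q Z =
    (\<Sum>k=1..K. (norm (J_matrix \<diamond> commutator (sim (A k) Q) (matrix_inv Q ** Z)))\<^sup>2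
      + 2 * (commutator (matrix_inv Q ** Z) (matrix_inv Q ** Z ** sim (A k) Q)
          \<bullet> (J_matrix \<diamond> sim (A k) Q)))"
proof -
  have 0: "diff_pow 0 (sim B) Q Z = sim B Q" for B
    by (simp add: diff_pow_def)
  have "(\<Sum>l=0..2. real (2 choose l) *
      (diff_pow (2 - l) (sim B) Q Z \<bullet> (J_matrix \<diamond> diff_pow l (sim B) Q Z))) =
      2 * ((norm (J_matrix \<diamond> commutator (sim B Q) (matrix_inv Q ** Z)))\<^sup>2
      + 2 * (commutator (matrix_inv Q ** Z) (matrix_inv Q ** Z ** sim B Q) \<bullet> (J_matrix \<diamond> sim B Q)))"
    for B
  proof -
    have "{0..2::nat} = {0,1,2}" by auto
    then show ?thesis
      using diff_pow_1_sim[OF Q, of B Z] diff_pow_2_sim[OF Q, of B Z]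
        inner_J_hadamard_commute[of "sim B Q"]
      by (simp add: 0 inner_J_hadamard_self)
  qed
  then show ?thesis
    unfolding diff_pow_f_functional[OF Q] by (simp add: sum_distrib_left add_divide_distrib)
qed

lemma frob_real_eq_inner: "frob_real A B = A \<bullet> B"
  by (simp add: frob_real_def inner_vec_def)

lemma Re_frob_complex_eq_inner: "Re (frob_complex A B) = A \<bullet> B"
  by (simp add: frob_complex_def inner_vec_def inner_complex_def)

theorem proposition4p2:
  shows
   "(\<forall>(K::nat) (A :: nat \<Rightarrow> real^'n^'n) (Q :: real^'n^'n) (Z :: real^'n^'n).
      invertible Q \<longrightarrow>
        (\<forall>j\<ge>1. diff_pow j (f_functional K A) Q Z =
           1/2 * (\<Sum>k=1..K. \<Sum>l=0..j. real (j choose l) *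
             frob_real (diff_pow (j - l) (sim (A k)) Q Z)
               (J_matrix \<diamond> diff_pow l (sim (A k)) Q Z)))
        \<and> diff_pow 1 (f_functional K A) Q Z =
           (\<Sum>k=1..K.
             frob_real (commutator (sim (A k) Q) (matrix_inv Q ** Z))
               (J_matrix \<diamond> sim (A k) Q))
        \<and> diff_pow 2 (f_functional K A) Q Z =
           (\<Sum>k=1..K.
             ((norm (J_matrix \<diamond> commutator (sim (A k) Q) (matrix_inv Q ** Z)))\<^sup>2
              + 2 * frob_real (commutator (matrix_inv Q ** Z) (matrix_inv Q ** Z ** sim (A k) Q))
                  (J_matrix \<diamond> sim (A k) Q))))
    \<and>
    (\<forall>(K::nat) (A :: nat \<Rightarrow> complex^'n^'n) (Q :: complex^'n^'n) (Z :: complex^'n^'n).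
      invertible Q \<longrightarrow>
        (\<forall>j\<ge>1. diff_pow j (f_functional K A) Q Z =
           1/2 * (\<Sum>k=1..K. \<Sum>l=0..j. real (j choose l) *
             Re (frob_complex (diff_pow (j - l) (sim (A k)) Q Z)
               (J_matrix \<diamond> diff_pow l (sim (A k)) Q Z))))
        \<and> diff_pow 1 (f_functional K A) Q Z =
           (\<Sum>k=1..K.
             Re (frob_complex (commutator (sim (A k) Q) (matrix_inv Q ** Z))
               (J_matrix \<diamond> sim (A k) Q)))
        \<and> diff_pow 2 (f_functional K A) Q Z =
           (\<Sum>k=1..K.
             ((norm (J_matrix \<diamond> commutator (sim (A k) Q) (matrix_inv Q ** Z)))\<^sup>2
              + 2 * Re (frob_complex (commutator (matrix_inv Q ** Z) (matrix_inv Q ** Z ** sim (A k) Q))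
                  (J_matrix \<diamond> sim (A k) Q)))))"
  unfolding frob_real_eq_inner Re_frob_complex_eq_inner
  by (intro conjI allI impI;
      rule diff_pow_1_f_functional diff_pow_2_f_functional diff_pow_f_functional; assumption)

end
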